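(* Let $q$ be a prime power, $E=\mathbb{F}_q^n$, and let $M$ be a $q$-matroid on $E$ of rank $r$. Then the $q$-complex $\Delta_M$ associated to $M$ is shellable. In fact, if $F_1,\dots,F_t$ is an ordering of the facets of $\Delta_M$ such that $F_i\preccurlyeq F_j$ and $F_i\ne F_j$ for all $1\le i<j\le t$, then $F_1,\dots,F_t$ is a shelling of $\Delta_M$.
   Context: A $q$-matroid on $E$ is a pair $M=(E,\rho)$ with $\rho$ from the set of subspaces of $E$ to $\mathbb{N}$ satisfying $0\le\rho(A)\le\dim A$, $\rho(A)\le\rho(B)$ for $A\subseteq B$, and $\rho(A+B)+\rho(A\cap B)\le\rho(A)+\rho(B)$. Its rank is $\rho(E)$. A subspace $A$ is independent if $\rho(A)=\dim A$. $\Delta_M$ is the set of independent subspaces of $M$; it is a $q$-complex (a set of subspaces closed under taking subspaces), whose facets (inclusion-maximal members) are the bases of $M$, all of dimension $r$. For a set $\mathcal{A}$ of subspaces, $\langle\mathcal{A}\rangle$ is the set of all subspaces contained in some member of $\mathcal{A}$. A $q$-complex is shellable if it is pure (all facets of equal dimension) and its facets admit a shelling: a linear order $F_1,\dots,F_t$ such that for each $j\ge2$, $\langle F_j\rangle\cap\langle F_1,\dots,F_{j-1}\rangle$ is generated by a nonempty set of subspaces of $F_j$ of dimension $\dim F_j-1$. The order $\preccurlyeq$: fix a total order $\prec$ on $\mathbb{F}_q$ with $0\prec1\prec\alpha$ for all $\alpha\notin\{0,1\}$, extended lexicographically to $\mathbb{F}_q^n$; $\min S$ is the $\prec$-least element of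 $S$. For an $r$-dimensional subspace $U$, take a row echelon generator matrix with rows top to bottom $u_r,\dots,u_1$ and set $U_0=\{\mathbf 0\}$, $U_i=\langle u_1,\dots,u_i\rangle$, $\overline{U}_i=U_i\setminus U_{i-1}$ (these depend only on $U$). For $r$-dimensional $U,V$, $U\preccurlyeq V$ iff $U=V$ or there is $1\le e\le r$ with $U_j=V_j$ for $j<e$, $U_e\ne V_e$ and $\min\overline{U}_e\prec\min\overline{V}_e$; this is a total order on $r$-dimensional subspaces. *)

theory Defs
  imports "HOL-Analysis.Analysis"
begin

text \<open>
  The ambient space $E = F_q^n$ is the type \<open>'a ^ 'n\<close> over a finite field \<open>'a\<close>; the linear order
  on \<open>'n\<close> is the left-to-right order of the coordinates.
\<close>

subsection \<open>q-matroids\<close>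

definition q_matroid :: "(('a::{field,finite} ^ 'n::{finite,linorder}) set \<Rightarrow> nat) \<Rightarrow> bool" where
  "q_matroid \<rho> \<longleftrightarrow>
     (\<forall>A. vec.subspace A \<longrightarrow> \<rho> A \<le> vec.dim A) \<and>
     (\<forall>A B. vec.subspace A \<longrightarrow> vec.subspace B \<longrightarrow> A \<subseteq> B \<longrightarrow> \<rho> A \<le> \<rho> B) \<and>
     (\<forall>A B. vec.subspace A \<longrightarrow> vec.subspace B \<longrightarrow>
        \<rho> {a + b | a b. a \<in> A \<and> b \<in> B} + \<rho> (A \<inter> B) \<le> \<rho> A + \<rho> B)"

definition independents ::
    "(('a::{field,finite} ^ 'n::{finite,linorder}) set \<Rightarrow> nat) \<Rightarrow> ('a, 'n) vec set set" where
  "independents \<rho> = {A. vec.subspace A \<and> \<rho> A = vec.dim A}"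


subsection \<open>q-complexes and shellability\<close>

definition q_complex :: "('a::{field,finite} ^ 'n::{finite,linorder}) set set \<Rightarrow> bool" where
  "q_complex \<Delta> \<longleftrightarrow>
     (\<forall>A\<in>\<Delta>. vec.subspace A) \<and>
     (\<forall>A\<in>\<Delta>. \<forall>B. vec.subspace B \<longrightarrow> B \<subseteq> A \<longrightarrow> B \<in> \<Delta>)"

definition facets :: "('a::{field,finite} ^ 'n::{finite,linorder}) set set \<Rightarrow> ('a, 'n) vec set set" where
  "facets \<Delta> = {F \<in> \<Delta>. \<forall>A\<in>\<Delta>. F \<subseteq> A \<longrightarrow> A = F}"

definition generated :: "('a::{field,finite} ^ 'n::{finite,linorder}) set set \<Rightarrow> ('a, 'n) vec set set" where
  "generated \<A> = {W. vec.subspace W \<and> (\<exists>A\<in>\<A>. W \<subseteq> A)}"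

definition pure :: "('a::{field,finite} ^ 'n::{finite,linorder}) set set \<Rightarrow> bool" where
  "pure \<Delta> \<longleftrightarrow> (\<forall>F\<in>facets \<Delta>. \<forall>G\<in>facets \<Delta>. vec.dim F = vec.dim G)"

text \<open>Lists are indexed from 0, so \<open>Fs ! j\<close> with \<open>1 \<le> j\<close> is $F_{j+1}$ and \<open>take j Fs\<close> lists its
  predecessors.\<close>

definition shelling ::
    "('a::{field,finite} ^ 'n::{finite,linorder}) set set \<Rightarrow> ('a, 'n) vec set list \<Rightarrow> bool" where
  "shelling \<Delta> Fs \<longleftrightarrow>
     distinct Fs \<and> set Fs = facets \<Delta> \<and>
     (\<forall>j. 1 \<le> j \<and> j < length Fs \<longrightarrow>
        (\<exists>\<A>. \<A> \<noteq> {} \<and>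
             (\<forall>A\<in>\<A>. vec.subspace A \<and> A \<subseteq> Fs ! j \<and> vec.dim A + 1 = vec.dim (Fs ! j)) \<and>
             generated {Fs ! j} \<inter> generated (set (take j Fs)) = generated \<A>))"

definition shellable :: "('a::{field,finite} ^ 'n::{finite,linorder}) set set \<Rightarrow> bool" where
  "shellable \<Delta> \<longleftrightarrow> q_complex \<Delta> \<and> pure \<Delta> \<and> (\<exists>Fs. shelling \<Delta> Fs)"


subsection \<open>The order on subspaces of a fixed dimension\<close>

definition scalar_order :: "('a::{field,finite}) rel \<Rightarrow> bool" where
  "scalar_order prec \<longleftrightarrow>
     strict_linear_order prec \<and> (0, 1) \<in> prec \<and> (\<forall>\<alpha>. \<alpha> \<notin> {0, 1} \<longrightarrow> (1, \<alpha>) \<in> prec)"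

definition lex_prec ::
    "('a::{field,finite}) rel \<Rightarrow> 'a ^ 'n::{finite,linorder} \<Rightarrow> ('a, 'n) vec \<Rightarrow> bool" where
  "lex_prec prec x y \<longleftrightarrow> (\<exists>i. (\<forall>j<i. x $ j = y $ j) \<and> (x $ i, y $ i) \<in> prec)"

definition lex_min ::
    "('a::{field,finite}) rel \<Rightarrow> ('a ^ 'n::{finite,linorder}) set \<Rightarrow> ('a, 'n) vec" where
  "lex_min prec S = (THE x. x \<in> S \<and> (\<forall>y\<in>S. y \<noteq> x \<longrightarrow> lex_prec prec x y))"

definition pivot :: "'a::{field,finite} ^ 'n::{finite,linorder} \<Rightarrow> 'n" where
  "pivot v = Min {i. v $ i \<noteq> 0}"

text \<open>A matrix is the list of its rows, from top to bottom. Only the echelon shape is required: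
  leading entries need not be 1, and the entries above them need not vanish.\<close>

definition row_echelon :: "('a::{field,finite} ^ 'n::{finite,linorder}) list \<Rightarrow> bool" where
  "row_echelon us \<longleftrightarrow> sorted_wrt (\<lambda>u v. v = 0 \<or> (u \<noteq> 0 \<and> pivot u < pivot v)) us"

definition echelon_generator ::
    "('a::{field,finite} ^ 'n::{finite,linorder}) set \<Rightarrow> ('a, 'n) vec list \<Rightarrow> bool" where
  "echelon_generator U us \<longleftrightarrow>
     row_echelon us \<and> length us = vec.dim U \<and> vec.span (set us) = U"

lemma echelon_generator_Cons:
  fixes U :: "('a::{field,finite} ^ 'n::{finite,linorder}) set"
  assumes "echelon_generator U (u # us)"
  shows "u \<noteq> 0" "\<forall>x\<in>U. \<forall>j<pivot u. x $ j = 0" "u $ pivot u \<noteq> 0" "u \<in> U"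
    "echelon_generator {x\<in>U. x $ pivot u = 0} us"
proof -
  have sp: "vec.span (set (u # us)) = U" and len: "length (u # us) = vec.dim U"
    and re: "row_echelon (u # us)"
    using assms unfolding echelon_generator_def by auto
  have dcard: "vec.dim (vec.span (set xs)) \<le> length xs" for xs :: "('a, 'n) vec list"
    using vec.dim_le_card'[of "set xs"] card_length[of xs] by (simp add: vec.dim_span)
  show u0: "u \<noteq> 0"
  proof
    assume "u = 0"
    then have "vec.span (set us) = U"
      using sp by (simp add: vec.span_insert_0)
    then show False using dcard[of us] len by simp
  qed
  have ne: "{i. u $ i \<noteq> 0} \<noteq> {}" using u0 by (auto simp: vec_eq_iff)
  show up: "u $ pivot u \<noteq> 0"
    using Min_in[OF _ ne] unfolding pivot_def by simp
  have below: "v $ j = 0" if "j < pivot v" for v :: "('a, 'n) vec" and j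
  proof (rule ccontr)
    assume "v $ j \<noteq> 0"
    then have "pivot v \<le> j" unfolding pivot_def by (intro Min_le) auto
    with that show False by simp
  qed
  have tl0: "v $ j = 0" if "v \<in> set us" "j \<le> pivot u" for v j
    using re that below[of j v] unfolding row_echelon_def by fastforce
  have sub0: "vec.subspace {x :: ('a, 'n) vec. x $ j = 0}" for j
    unfolding vec.subspace_def by auto
  have tlsp: "v $ j = 0" if "v \<in> vec.span (set us)" "j \<le> pivot u" for v j
    using vec.span_minimal[OF _ sub0[of j], of "set us"] tl0 that by blast
  have dec: "\<exists>c. x - c *s u \<in> vec.span (set us)" if "x \<in> U" for x
    using that vec.span_breakdown_eq[of x u "set us"] by (simp flip: sp)
  show "\<forall>x\<in>U. \<forall>j<pivot u. x $ j = 0"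
  proof (intro ballI allI impI)
    fix x j assume "x \<in> U" and j: "j < pivot u"
    then obtain c where c: "x - c *s u \<in> vec.span (set us)" using dec by blast
    show "x $ j = 0" using tlsp[OF c less_imp_le[OF j]] below[OF j] by simp
  qed
  show uU: "u \<in> U" using vec.span_base[of u "set (u # us)"] sp by simp
  have eq: "vec.span (set us) = {x\<in>U. x $ pivot u = 0}"
  proof (intro equalityI subsetI)
    fix x assume x: "x \<in> vec.span (set us)"
    then have "x \<in> U" using sp vec.span_mono[of "set us" "set (u # us)"] by auto
    then show "x \<in> {x\<in>U. x $ pivot u = 0}" using tlsp[OF x] by simp
  next
    fix x assume x: "x \<in> {x\<in>U. x $ pivot u = 0}"
    then obtain c where c: "x - c *s u \<in> vec.span (set us)" using dec by blast
    then have "c = 0" using tlsp[OF c order_refl] x up by simp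
    then show "x \<in> vec.span (set us)" using c by simp
  qed
  have "u \<notin> vec.span (set us)" using eq up by auto
  then have "vec.dim U = Suc (vec.dim (vec.span (set us)))"
    using vec.dim_insert[of u "set us"] sp vec.dim_span[of "set (u # us)"] by (simp add: vec.dim_span)
  then show "echelon_generator {x\<in>U. x $ pivot u = 0} us"
    using re len eq unfolding echelon_generator_def row_echelon_def by auto
qed

lemma echelon_generator_exists:
  fixes U :: "('a::{field,finite} ^ 'n::{finite,linorder}) set"
  assumes "vec.subspace U"
  shows "\<exists>us. echelon_generator U us"
  using assms
proof (induction "vec.dim U" arbitrary: U rule: less_induct)
  case less
  show ?case
  proof (cases "U \<subseteq> {0}")
    case True
    then have "U = {0}" using less.prems vec.subspace_0 by blast
    then show ?thesis
      by (intro exI[of _ "[]"]) (simp add: echelon_generator_def row_echelon_def)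
  next
    case False
    let ?I = "{i. \<exists>x\<in>U. x $ i \<noteq> 0}"
    define p where "p = Min ?I"
    have ne: "?I \<noteq> {}" using False by (auto simp: vec_eq_iff)
    then have "p \<in> ?I" unfolding p_def by (intro Min_in) auto
    then obtain u where u: "u \<in> U" "u $ p \<noteq> 0" by auto
    have low: "x $ j = 0" if "x \<in> U" "j < p" for x j
    proof (rule ccontr)
      assume "x $ j \<noteq> 0"
      then have "p \<le> j" unfolding p_def using that(1) by (intro Min_le) auto
      with that(2) show False by simp
    qed
    have piv: "pivot u = p"
      unfolding pivot_def using u low[OF u(1)] by (intro Min_eqI) (auto simp: not_less[symmetric])
    let ?V = "{x\<in>U. x $ p = 0}"
    have sV: "vec.subspace ?V" using less.prems unfolding vec.subspace_def by auto
    have uV: "u \<notin> vec.span ?V" using u unfolding vec.span_eq_iff[THEN iffD2, OF sV] by auto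
    have spU: "vec.span (insert u ?V) = U"
    proof (intro equalityI subsetI)
      fix x assume "x \<in> vec.span (insert u ?V)"
      then show "x \<in> U" using vec.span_minimal[OF _ less.prems, of "insert u ?V"] u by auto
    next
      fix x assume x: "x \<in> U"
      have "x - (x $ p / u $ p) *s u \<in> ?V"
        using x u less.prems by (auto intro!: vec.subspace_diff vec.subspace_scale)
      then have "x - (x $ p / u $ p) *s u \<in> vec.span ?V" by (rule vec.span_base)
      then show "x \<in> vec.span (insert u ?V)" unfolding vec.span_breakdown_eq by (rule exI)
    qed
    have d: "vec.dim U = Suc (vec.dim ?V)"
      using vec.dim_insert[of u ?V] uV vec.dim_span[of "insert u ?V"] spU by simp
    then obtain us where us: "echelon_generator ?V us" using less.hyps[OF _ sV] by auto
    have spus: "vec.span (set us) = ?V" using us unfolding echelon_generator_def by simp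
    have "v = 0 \<or> (u \<noteq> 0 \<and> pivot u < pivot v)" if v: "v \<in> set us" for v
    proof (cases "v = 0")
      case False
      have vV: "v \<in> ?V" using v spus vec.span_base by blast
      have "{i. v $ i \<noteq> 0} \<noteq> {}" using False by (auto simp: vec_eq_iff)
      then have "v $ pivot v \<noteq> 0" using Min_in[of "{i. v $ i \<noteq> 0}"] unfolding pivot_def by simp
      then have "p < pivot v" using vV low[of v "pivot v"] by (cases p "pivot v" rule: linorder_cases) auto
      then show ?thesis using piv u by auto
    qed simp
    moreover have "vec.span (set (u # us)) = U"
      using spU unfolding spus[symmetric] by (simp add: vec.span_insert vec.span_span)
    ultimately have "echelon_generator U (u # us)"
      using us d unfolding echelon_generator_def row_echelon_def by auto
    then show ?thesis by blast
  qed
qed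

lemma echelon_generator_span_drop_unique:
  assumes "echelon_generator U us" "echelon_generator U vs"
  shows "vec.span (set (drop k us)) = vec.span (set (drop k vs))"
  using assms
proof (induction us arbitrary: U vs k)
  case Nil
  then have "length vs = 0" unfolding echelon_generator_def by auto
  then show ?case by simp
next
  case (Cons u us)
  then have "length vs = length (u # us)" by (simp add: echelon_generator_def)
  then obtain v vs' where vs: "vs = v # vs'" by (cases vs) auto
  note U = echelon_generator_Cons[OF Cons.prems(1)]
  note V = echelon_generator_Cons[OF Cons.prems(2)[unfolded vs]]
  have "pivot u = pivot v"
  proof (rule ccontr)
    assume "pivot u \<noteq> pivot v"
    then consider "pivot u < pivot v" | "pivot v < pivot u" by (rule linorder_neqE)
    then show False using U(2-4) V(2-4) by cases blast+
  qed
  then have "vec.span (set (drop m us)) = vec.span (set (drop m vs'))" for m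
    using Cons.IH[OF U(5)] V(5) by simp
  moreover have "vec.span (set (u # us)) = vec.span (set vs)"
    using Cons.prems by (simp add: echelon_generator_def)
  ultimately show ?case using vs by (cases k) auto
qed

text \<open>With rows $u_r, \dots, u_1$ from top to bottom, $U_i$ is spanned by the last $i$ rows. By the
  two preceding lemmas a generator matrix exists and $U_i$ does not depend on the one chosen.\<close>

definition tower :: "('a::{field,finite} ^ 'n::{finite,linorder}) set \<Rightarrow> nat \<Rightarrow> ('a, 'n) vec set" where
  "tower U i = vec.span (set (take i (rev (SOME us. echelon_generator U us))))"

lemma tower_eq:
  assumes "echelon_generator U us"
  shows "tower U i = vec.span (set (take i (rev us)))"
proof -
  let ?vs = "SOME us. echelon_generator U us"
  have vs: "echelon_generator U ?vs" using assms by (rule someI)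
  then have "length ?vs = length us" using assms by (simp add: echelon_generator_def)
  then show ?thesis
    using echelon_generator_span_drop_unique[OF vs assms, of "length us - i"]
    by (simp add: tower_def take_rev)
qed

definition tower_layer :: "('a::{field,finite} ^ 'n::{finite,linorder}) set \<Rightarrow> nat \<Rightarrow> ('a, 'n) vec set" where
  "tower_layer U i = tower U i - tower U (i - 1)"

definition subspace_le ::
    "('a::{field,finite}) rel \<Rightarrow> nat \<Rightarrow> ('a ^ 'n::{finite,linorder}) set \<Rightarrow> ('a, 'n) vec set \<Rightarrow> bool" where
  "subspace_le prec r U V \<longleftrightarrow>
     U = V \<or>
     (\<exists>e. 1 \<le> e \<and> e \<le> r \<and> (\<forall>j<e. tower U j = tower V j) \<and> tower U e \<noteq> tower V e \<and>
          lex_prec prec (lex_min prec (tower_layer U e)) (lex_min prec (tower_layer V e)))"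

end

theory Submission
  imports Defs
begin

text \<open>
  For distinct subspaces $U, V$ of equal dimension, $U \preccurlyeq V$ forces the $\prec$-least element
  of the symmetric difference of $U$ and $V$ to lie in $U$. Let $U, V$ be bases with $U$ before $V$,
  and let $x$ be that least element. Extending $(U \cap V) + \langle x\rangle$ to a basis $B$ inside
  $V + \langle x\rangle$ gives $U \cap V \subseteq B \cap V$ with $B \cap V$ of codimension one in $V$.
  Moreover $V \setminus B \subseteq V \setminus U$, so $x \in B \setminus V$ is smaller than every
  element of $V \setminus B$, and hence $B$ comes before $V$. This works for an arbitrary linear order
  of the vectors.
\<close>

subsection \<open>q-matroids\<close>

lemma dim_span_insert_notin:
  fixes A :: "('a::field ^ 'n::finite) set"
  assumes "vec.subspace A" "x \<notin> A"
  shows "vec.dim (vec.span (insert x A)) = Suc (vec.dim A)"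
  using assms vec.dim_insert[of x A] by (simp add: vec.dim_span vec.span_eq_iff[THEN iffD2])

lemma sum_span_insert:
  fixes A C :: "('a::field ^ 'n::finite) set"
  assumes "vec.subspace A" "vec.subspace C" "A \<subseteq> C"
  shows "{a + b | a b. a \<in> C \<and> b \<in> vec.span (insert x A)} = vec.span (insert x C)"
proof -
  have "{a + b | a b. a \<in> C \<and> b \<in> vec.span (insert x A)} = vec.span (C \<union> insert x A)"
    using assms(2) by (simp only: vec.span_Un vec.span_eq_iff[THEN iffD2] vec.span_span)
  also have "C \<union> insert x A = insert x C" using assms(3) by auto
  finally show ?thesis .
qed

lemma q_matroid_le_dim:
  assumes "q_matroid \<rho>" "vec.subspace A"
  shows "\<rho> A \<le> vec.dim A"
  using assms unfolding q_matroid_def by blast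

lemma q_matroid_mono:
  assumes "q_matroid \<rho>" "vec.subspace A" "vec.subspace B" "A \<subseteq> B"
  shows "\<rho> A \<le> \<rho> B"
  using assms unfolding q_matroid_def by blast

text \<open>Diminishing returns: submodularity is applied to \<open>C\<close> and
  \<open>A + <x>\<close>, whose sum is \<open>C + <x>\<close> and whose intersection contains
  \<open>A\<close>.\<close>

lemma q_matroid_submodular_insert:
  assumes "q_matroid \<rho>" "vec.subspace A" "vec.subspace C" "A \<subseteq> C"
  shows "\<rho> (vec.span (insert x C)) + \<rho> A \<le> \<rho> C + \<rho> (vec.span (insert x A))"
proof -
  let ?A' = "vec.span (insert x A)"
  have "\<rho> {a + b | a b. a \<in> C \<and> b \<in> ?A'} + \<rho> (C \<inter> ?A') \<le> \<rho> C + \<rho> ?A'"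
    using assms(1,3) vec.subspace_span[of "insert x A"] unfolding q_matroid_def by blast
  moreover have "\<rho> A \<le> \<rho> (C \<inter> ?A')"
    using assms(4) vec.span_superset[of "insert x A"]
    by (intro q_matroid_mono[OF assms(1,2)] vec.subspace_inter assms vec.subspace_span) auto
  ultimately show ?thesis by (simp add: sum_span_insert[OF assms(2-4)])
qed

lemma q_matroid_insert_le:
  assumes "q_matroid \<rho>" "vec.subspace A"
  shows "\<rho> (vec.span (insert x A)) \<le> Suc (\<rho> A)"
proof -
  \<comment> \<open>\<open>{x, 0}\<close> is \<open>insert x {0}\<close>, so diminishing returns
    starting from the zero space bounds the gain by the rank of a line.\<close>
  have "\<rho> (vec.span {x, 0}) \<le> vec.dim (vec.span {x, 0})"
    by (intro q_matroid_le_dim[OF assms(1)] vec.subspace_span)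
  also have "\<dots> \<le> 1"
    using vec.dim_le_card'[of "{x}"] by (simp add: vec.dim_span insert_commute vec.span_insert_0)
  finally show ?thesis
    using q_matroid_submodular_insert[OF assms(1) vec.subspace_single_0 assms(2), of x]
      vec.subspace_0[OF assms(2)] by simp
qed

text \<open>One vector of \<open>B - A\<close> is adjoined at a time, each raising the rank by at
  most one. The additive form avoids subtraction on naturals.\<close>

lemma q_matroid_le_add_codim:
  assumes "q_matroid \<rho>" "vec.subspace A" "vec.subspace B" "A \<subseteq> B"
  shows "\<rho> B + vec.dim A \<le> \<rho> A + vec.dim B"
  using assms(2,4)
proof (induction "vec.dim B - vec.dim A" arbitrary: A rule: less_induct)
  case less
  show ?case
  proof (cases "A = B")
    case False
    then obtain x where x: "x \<in> B" "x \<notin> A" using less.prems by blast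
    let ?A = "vec.span (insert x A)"
    have sub: "?A \<subseteq> B" using x less.prems by (intro vec.span_minimal assms(3)) auto
    have d: "vec.dim ?A = Suc (vec.dim A)"
      by (rule dim_span_insert_notin[OF less.prems(1) x(2)])
    have "vec.dim ?A \<le> vec.dim B" by (rule vec.dim_subset[OF sub])
    with d have "\<rho> B + vec.dim ?A \<le> \<rho> ?A + vec.dim B"
      by (intro less.hyps sub vec.subspace_span) simp
    then show ?thesis using q_matroid_insert_le[OF assms(1) less.prems(1), of x] d by simp
  qed simp
qed

lemma q_complex_independents:
  assumes "q_matroid \<rho>"
  shows "q_complex (independents \<rho>)"
proof -
  \<comment> \<open>When \<open>A\<close> has full rank, the codimension bound for \<open>B\<close>
    inside \<open>A\<close> reads \<open>vec.dim B \<le> \<rho> B\<close>.\<close>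
  have "\<rho> B = vec.dim B" if "vec.subspace A" "\<rho> A = vec.dim A" "vec.subspace B" "B \<subseteq> A" for A B
    using q_matroid_le_add_codim[OF assms that(3,1,4)] q_matroid_le_dim[OF assms that(3)] that(2)
    by simp
  then show ?thesis unfolding q_complex_def independents_def by blast
qed

text \<open>\<open>A\<close> is enlarged to \<open>X\<close> one vector at a time. A vector that
  does not raise the rank of \<open>A\<close> does not raise that of a larger subspace, by
  diminishing returns.\<close>

lemma q_matroid_closure:
  assumes M: "q_matroid \<rho>" and A: "vec.subspace A" and X: "vec.subspace X" and "A \<subseteq> X"
    and cl: "\<And>x. x \<in> X \<Longrightarrow> \<rho> (vec.span (insert x A)) \<le> \<rho> A"
  shows "\<rho> X \<le> \<rho> A"
proof -
  have "\<rho> X \<le> \<rho> A" if "vec.subspace C" "A \<subseteq> C" "C \<subseteq> X" "\<rho> C \<le> \<rho> A" for C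
    using that
  proof (induction "vec.dim X - vec.dim C" arbitrary: C rule: less_induct)
    case less
    show ?case
    proof (cases "C = X")
      case False
      then obtain x where x: "x \<in> X" "x \<notin> C" using less.prems by blast
      let ?C = "vec.span (insert x C)"
      have sub: "?C \<subseteq> X" using x less.prems by (intro vec.span_minimal X) auto
      have "vec.dim ?C = Suc (vec.dim C)" by (rule dim_span_insert_notin[OF less.prems(1) x(2)])
      moreover have "vec.dim ?C \<le> vec.dim X" by (rule vec.dim_subset[OF sub])
      moreover have "\<rho> ?C \<le> \<rho> A"
        using q_matroid_submodular_insert[OF M A less.prems(1,2), of x] less.prems(4) cl[OF x(1)]
        by simp
      moreover have "A \<subseteq> ?C" using less.prems(2) vec.span_superset[of "insert x C"] by blast
      ultimately show ?thesis using sub by (intro less.hyps[of ?C] vec.subspace_span) simp_all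
    qed (use less.prems in simp)
  qed
  then show ?thesis using A \<open>A \<subseteq> X\<close> by blast
qed

text \<open>Greedy extension: a vector of \<open>X\<close> that raises the rank of \<open>I\<close>
  is adjoined as long as there is one; once there is none, the closure argument shows that
  \<open>I\<close> already has the rank of \<open>X\<close>.\<close>

lemma independent_extend:
  assumes M: "q_matroid \<rho>" and X: "vec.subspace X" and "I \<in> independents \<rho>" "I \<subseteq> X"
  obtains B where "B \<in> independents \<rho>" "I \<subseteq> B" "B \<subseteq> X" "vec.dim B = \<rho> X"
proof -
  have "\<exists>B. B \<in> independents \<rho> \<and> I \<subseteq> B \<and> B \<subseteq> X \<and> vec.dim B = \<rho> X"
    using assms(3,4)
  proof (induction "vec.dim X - vec.dim I" arbitrary: I rule: less_induct)
    case less
    have I: "vec.subspace I" "\<rho> I = vec.dim I" using less.prems by (auto simp: independents_def)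
    show ?case
    proof (cases "\<exists>x\<in>X. \<rho> I < \<rho> (vec.span (insert x I))")
      case True
      then obtain x where x: "x \<in> X" "\<rho> I < \<rho> (vec.span (insert x I))" by blast
      let ?I = "vec.span (insert x I)"
      have "x \<notin> I"
      proof
        assume "x \<in> I"
        then have "?I = I" using I(1) by (simp add: insert_absorb vec.span_eq_iff[THEN iffD2])
        then show False using x(2) by simp
      qed
      then have d: "vec.dim ?I = Suc (vec.dim I)" by (rule dim_span_insert_notin[OF I(1)])
      \<comment> \<open>The rank exceeds \<open>vec.dim I\<close> and is bounded by the new
        dimension, which is one more.\<close>
      have ind: "?I \<in> independents \<rho>"
        using q_matroid_le_dim[OF M vec.subspace_span, of "insert x I"] d x(2) I(2)
        by (simp add: independents_def)
      have sub: "?I \<subseteq> X" using x less.prems by (intro vec.span_minimal X) auto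
      have "vec.dim ?I \<le> vec.dim X" by (rule vec.dim_subset[OF sub])
      then obtain B where "B \<in> independents \<rho>" "?I \<subseteq> B" "B \<subseteq> X" "vec.dim B = \<rho> X"
        using less.hyps[OF _ ind sub] d diff_less_mono2[of "vec.dim I" "vec.dim ?I" "vec.dim X"]
        by auto
      then show ?thesis using vec.span_superset[of "insert x I"] by blast
    next
      case False
      then have "\<rho> X \<le> \<rho> I"
        by (intro q_matroid_closure[OF M I(1) X less.prems(2)]) (simp add: not_less)
      then show ?thesis
        using q_matroid_mono[OF M I(1) X less.prems(2)] less.prems I(2) by (intro exI[of _ I]) simp
    qed
  qed
  then show ?thesis using that by blast
qed

section \<open>Bases and exchange\<close>

lemma independent_dim_le_rank:
  assumes "q_matroid \<rho>" "A \<in> independents \<rho>"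
  shows "vec.dim A \<le> \<rho> UNIV"
  using assms q_matroid_mono[OF assms(1) _ vec.subspace_UNIV, of A] by (auto simp: independents_def)

text \<open>Every independent subspace extends to one of dimension \<open>\<rho> UNIV\<close>, and
  none is larger. This yields purity.\<close>

lemma facets_independents:
  assumes M: "q_matroid \<rho>"
  shows "facets (independents \<rho>) = {F \<in> independents \<rho>. vec.dim F = \<rho> UNIV}"
proof (intro equalityI subsetI)
  fix F assume F: "F \<in> facets (independents \<rho>)"
  then have ind: "F \<in> independents \<rho>" by (simp add: facets_def)
  obtain B where "B \<in> independents \<rho>" "F \<subseteq> B" "vec.dim B = \<rho> UNIV"
    by (rule independent_extend[OF M vec.subspace_UNIV ind subset_UNIV])
  with F ind show "F \<in> {F \<in> independents \<rho>. vec.dim F = \<rho> UNIV}" by (auto simp: facets_def)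
next
  fix F assume F: "F \<in> {F \<in> independents \<rho>. vec.dim F = \<rho> UNIV}"
  have "A = F" if "A \<in> independents \<rho>" "F \<subseteq> A" for A
    using F that independent_dim_le_rank[OF M that(1)]
    by (intro vec.subspace_dim_equal[symmetric]) (auto simp: independents_def)
  with F show "F \<in> facets (independents \<rho>)" by (auto simp: facets_def)
qed

text \<open>The new basis is sought inside \<open>V + <x>\<close>, which has dimension only one more
  than \<open>V\<close>; this forces it to meet \<open>V\<close> in a hyperplane of
  \<open>V\<close>.\<close>

lemma facet_exchange:
  assumes M: "q_matroid \<rho>" and U: "U \<in> facets (independents \<rho>)"
    and V: "V \<in> facets (independents \<rho>)" and x: "x \<in> U" "x \<notin> V"
  obtains B where "B \<in> facets (independents \<rho>)" "x \<in> B" "U \<inter> V \<subseteq> B"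
    "vec.dim (B \<inter> V) + 1 = vec.dim V"
proof -
  have sU: "vec.subspace U" and indU: "U \<in> independents \<rho>"
    and sV: "vec.subspace V" and rV: "\<rho> V = \<rho> UNIV" and dV: "vec.dim V = \<rho> UNIV"
    using U V unfolding facets_independents[OF M] by (auto simp: independents_def)
  let ?I = "vec.span (insert x (U \<inter> V))" and ?X = "vec.span (insert x V)"
  have "?I \<subseteq> U" using x by (intro vec.span_minimal sU) auto
  then have I: "?I \<in> independents \<rho>"
    using q_complex_independents[OF M] indU vec.subspace_span[of "insert x (U \<inter> V)"]
    unfolding q_complex_def by blast
  have IX: "?I \<subseteq> ?X" by (intro vec.span_mono) auto
  have VX: "V \<subseteq> ?X" using vec.span_superset[of "insert x V"] by auto
  \<comment> \<open>\<open>?X\<close> contains the basis \<open>V\<close>, so an independent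
    subspace of dimension \<open>\<rho> ?X\<close> is again a basis.\<close>
  have rX: "\<rho> ?X = \<rho> UNIV"
    using q_matroid_mono[OF M sV vec.subspace_span VX] rV
      q_matroid_mono[OF M vec.subspace_span vec.subspace_UNIV subset_UNIV, of "insert x V"] by simp
  obtain B where B: "B \<in> independents \<rho>" "?I \<subseteq> B" "B \<subseteq> ?X" "vec.dim B = \<rho> ?X"
    using independent_extend[OF M vec.subspace_span I IX] by blast
  have sB: "vec.subspace B" using B(1) by (simp add: independents_def)
  have xB: "x \<in> B" and IB: "U \<inter> V \<subseteq> B"
    using B(2) vec.span_superset[of "insert x (U \<inter> V)"] by auto
  \<comment> \<open>\<open>B + V\<close> is all of \<open>?X\<close>, of dimension
    \<open>\<rho> UNIV + 1\<close>, so the dimension formula determines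
    \<open>vec.dim (B \<inter> V)\<close>.\<close>
  have "{a + b | a b. a \<in> B \<and> b \<in> V} = vec.span (B \<union> V)"
    by (simp add: vec.span_Un vec.span_eq_iff[THEN iffD2] sB sV)
  also have "\<dots> = ?X"
  proof
    show "vec.span (B \<union> V) \<subseteq> ?X" using B(3) VX by (intro vec.span_minimal vec.subspace_span) auto
    show "?X \<subseteq> vec.span (B \<union> V)" using xB by (intro vec.span_mono) auto
  qed
  finally have "vec.dim ?X + vec.dim (B \<inter> V) = vec.dim B + vec.dim V"
    using vec.dim_sums_Int[OF sB sV] by simp
  then have "vec.dim (B \<inter> V) + 1 = vec.dim V"
    using dim_span_insert_notin[OF sV x(2)] B(4) rX dV by simp
  moreover have "B \<in> facets (independents \<rho>)" using B(1,4) rX by (simp add: facets_independents[OF M])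
  ultimately show ?thesis using that xB IB by blast
qed

subsection \<open>Comparing sets by the least element of their symmetric difference\<close>

text \<open>For finite sets and a linear \<open>lt\<close>, this says that the least element of the
  symmetric difference lies in \<open>U\<close>. The witness is compared with \<open>V - U\<close>
  only, so it need not be that least element.\<close>

definition set_prec :: "('b \<Rightarrow> 'b \<Rightarrow> bool) \<Rightarrow> 'b set \<Rightarrow> 'b set \<Rightarrow> bool" where
  "set_prec lt U V \<longleftrightarrow> (\<exists>x\<in>U - V. \<forall>y\<in>V - U. lt x y)"

lemma set_prec_asym:
  assumes "asymp lt" "set_prec lt U V"
  shows "\<not> set_prec lt V U"
  using assms unfolding set_prec_def by (metis asympD)

text \<open>Each intersection of \<open>Fs ! j\<close> with an earlier facet lies in a hyperplane of
  \<open>Fs ! j\<close> that is cut out by a possibly different earlier facet, found by exchange.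
  Asymmetry of \<open>lt\<close> ensures that the exchanged basis does come earlier in the
  list.\<close>

lemma shelling_if_set_prec:
  fixes \<rho> :: "('a::{field,finite} ^ 'n::{finite,linorder}) set \<Rightarrow> nat"
  assumes M: "q_matroid \<rho>" and set: "set Fs = facets (independents \<rho>)" and asym: "asymp lt"
    and ord: "\<And>i j. i < j \<Longrightarrow> j < length Fs \<Longrightarrow> set_prec lt (Fs ! i) (Fs ! j)"
  shows "shelling (independents \<rho>) Fs"
proof -
  have "distinct Fs"
    unfolding distinct_conv_nth
  proof (intro allI impI)
    fix i j assume "i < length Fs" "j < length Fs" "i \<noteq> j"
    then show "Fs ! i \<noteq> Fs ! j"
      using ord[of i j] ord[of j i] by (cases i j rule: linorder_cases) (auto simp: set_prec_def)
  qed
  moreover have "\<exists>\<A>. \<A> \<noteq> {} \<and>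
      (\<forall>A\<in>\<A>. vec.subspace A \<and> A \<subseteq> Fs ! j \<and> vec.dim A + 1 = vec.dim (Fs ! j)) \<and>
      generated {Fs ! j} \<inter> generated (set (take j Fs)) = generated \<A>"
    if j: "1 \<le> j" "j < length Fs" for j
  proof -
    let ?V = "Fs ! j"
    have sub: "vec.subspace (Fs ! i)" if "i < length Fs" for i
      using set nth_mem[OF that] by (auto simp: facets_def independents_def)
    \<comment> \<open>The generators are the intersections with earlier facets that have codimension
      one; \<open>key\<close> shows that they cover all other such intersections.\<close>
    define \<A> where "\<A> = {Fs ! k \<inter> ?V | k. k < j \<and> vec.dim (Fs ! k \<inter> ?V) + 1 = vec.dim ?V}"
    have key: "\<exists>A\<in>\<A>. Fs ! i \<inter> ?V \<subseteq> A" if i: "i < j" for i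
    proof -
      obtain x where x: "x \<in> Fs ! i" "x \<notin> ?V" and less: "\<And>y. y \<in> ?V - Fs ! i \<Longrightarrow> lt x y"
        using ord[OF i j(2)] by (auto simp: set_prec_def)
      obtain B where B: "B \<in> facets (independents \<rho>)" "x \<in> B" "Fs ! i \<inter> ?V \<subseteq> B"
          "vec.dim (B \<inter> ?V) + 1 = vec.dim ?V"
        by (rule facet_exchange[OF M _ _ x]) (use i j(2) in \<open>auto simp flip: set\<close>)
      \<comment> \<open>As \<open>B\<close> contains \<open>Fs ! i \<inter> ?V\<close>, the set
        \<open>?V - B\<close> lies in \<open>?V - Fs ! i\<close>, so the same \<open>x\<close> is a
        witness.\<close>
      have "set_prec lt B ?V" unfolding set_prec_def using x B(2,3) less by blast
      obtain k where k: "k < length Fs" "B = Fs ! k" using B(1) set by (metis in_set_conv_nth)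
      have "k \<noteq> j" using k(2) B(2) x(2) by auto
      moreover have "\<not> j < k"
        using ord[of j k] k set_prec_asym[OF asym \<open>set_prec lt B ?V\<close>] by auto
      ultimately have "k < j" by simp
      then have "B \<inter> ?V \<in> \<A>" using B(4) k(2) by (auto simp: \<A>_def)
      then show ?thesis using B(3) by (intro bexI[of _ "B \<inter> ?V"]) auto
    qed
    \<comment> \<open>Since \<open>1 \<le> j\<close>, the facet with index 0 precedes
      \<open>?V\<close>.\<close>
    have "\<A> \<noteq> {}" using key[of 0] j by auto
    moreover have "vec.subspace A \<and> A \<subseteq> ?V \<and> vec.dim A + 1 = vec.dim ?V" if "A \<in> \<A>" for A
      using that sub j(2) unfolding \<A>_def by (auto intro!: vec.subspace_inter)
    moreover have "generated {?V} \<inter> generated (set (take j Fs)) = generated \<A>"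
    proof (intro equalityI subsetI)
      fix W assume "W \<in> generated {?V} \<inter> generated (set (take j Fs))"
      then obtain i where "vec.subspace W" "W \<subseteq> ?V" "i < j" "W \<subseteq> Fs ! i"
        using j(2) by (auto simp: generated_def in_set_conv_nth)
      then show "W \<in> generated \<A>" using key[of i] unfolding generated_def by blast
    next
      fix W assume "W \<in> generated \<A>"
      then obtain k where W: "vec.subspace W" "W \<subseteq> Fs ! k" "W \<subseteq> ?V" "k < j"
        by (auto simp: generated_def \<A>_def)
      then have "Fs ! k \<in> set (take j Fs)" using j(2) by (auto simp: in_set_conv_nth)
      then show "W \<in> generated {?V} \<inter> generated (set (take j Fs))"
        using W by (auto simp: generated_def)
    qed
    ultimately show ?thesis by blast
  qed
  ultimately show ?thesis using set unfolding shelling_def by blast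
qed

section \<open>Linearity of the set comparison and existence of a shelling\<close>

lemma set_prec_total_if_linear:
  assumes "finite U" "finite V" "U \<noteq> V" "transp lt" "totalp lt"
  shows "set_prec lt U V \<or> set_prec lt V U"
proof -
  let ?D = "(U - V) \<union> (V - U)"
  have "\<exists>m\<in>?D. \<forall>y\<in>?D. y \<noteq> m \<longrightarrow> lt m y"
    using assms by (intro Finite_Set.bex_least_element) (auto intro: transp_on_subset totalp_on_subset)
  then obtain m where m: "m \<in> ?D" "\<And>y. y \<in> ?D \<Longrightarrow> y \<noteq> m \<Longrightarrow> lt m y" by blast
  then consider "m \<in> U - V" | "m \<in> V - U" by blast
  then show ?thesis
  proof cases
    case 1
    then have "\<forall>y\<in>V - U. lt m y" using m(2) by auto
    with 1 show ?thesis unfolding set_prec_def by blast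
  next
    case 2
    then have "\<forall>y\<in>U - V. lt m y" using m(2) by auto
    with 2 show ?thesis unfolding set_prec_def by blast
  qed
qed

text \<open>Otherwise the least element \<open>m\<close> of the symmetric difference of
  \<open>U\<close> and \<open>W\<close> lies in \<open>W\<close>. The witnesses \<open>x\<close> and
  \<open>y\<close> both fall below \<open>m\<close>, where \<open>U\<close> and \<open>W\<close>
  agree, and each would then precede the other.\<close>

lemma set_prec_trans_if_linear:
  assumes fin: "finite U" "finite W" and lin: "transp lt" "asymp lt" "totalp lt"
    and UV: "set_prec lt U V" and VW: "set_prec lt V W"
  shows "set_prec lt U W"
proof (rule ccontr)
  assume not: "\<not> ?thesis"
  obtain x where x: "x \<in> U" "x \<notin> V" "\<And>z. z \<in> V \<Longrightarrow> z \<notin> U \<Longrightarrow> lt x z"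
    using UV by (auto simp: set_prec_def)
  obtain y where y: "y \<in> V" "y \<notin> W" "\<And>z. z \<in> W \<Longrightarrow> z \<notin> V \<Longrightarrow> lt y z"
    using VW by (auto simp: set_prec_def)
  let ?D = "(U - W) \<union> (W - U)"
  have "U \<noteq> W" using set_prec_asym[OF lin(2) UV] VW by auto
  then have "\<exists>m\<in>?D. \<forall>z\<in>?D. z \<noteq> m \<longrightarrow> lt m z"
    using fin lin by (intro Finite_Set.bex_least_element) (auto intro: transp_on_subset totalp_on_subset)
  then obtain m where m: "m \<in> ?D" "\<And>z. z \<in> ?D \<Longrightarrow> z \<noteq> m \<Longrightarrow> lt m z" by blast
  then have mW: "m \<in> W" "m \<notin> U" using not by (auto simp: set_prec_def)
  have below: "z \<in> U \<longleftrightarrow> z \<in> W" if "lt z m" for z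
    using m(2)[of z] asympD[OF lin(2) that] that by (cases "z = m") auto
  have tr: "lt a c" if "lt a b" "lt b c" for a b c using transpD[OF lin(1)] that by blast
  have "lt x m \<and> lt y m"
    using x y mW below tr by (cases "m \<in> V") metis+
  then have "lt x y" "lt y x" using x y below by auto
  then show False using asympD[OF lin(2)] by blast
qed

lemma finite_list_of_linear_rel:
  assumes "finite S" "transp_on S R" "totalp_on S R"
  shows "\<exists>xs. set xs = S \<and> sorted_wrt R xs"
  using assms
proof (induction "card S" arbitrary: S)
  case (Suc n)
  then have "S \<noteq> {}" by auto
  with Suc.prems obtain m where m: "m \<in> S" "\<forall>x\<in>S. x \<noteq> m \<longrightarrow> R m x"
    using Finite_Set.bex_least_element[of S R] by blast
  have "\<exists>xs. set xs = S - {m} \<and> sorted_wrt R xs"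
    using Suc.prems Suc.hyps(2) m(1)
    by (intro Suc.hyps(1)) (auto intro: transp_on_subset totalp_on_subset)
  then obtain xs where "set xs = S - {m}" "sorted_wrt R xs" by blast
  then show ?case using m by (intro exI[of _ "m # xs"]) auto
qed simp

lemma shellable_independents:
  fixes \<rho> :: "('a::{field,finite} ^ 'n::{finite,linorder}) set \<Rightarrow> nat"
  assumes M: "q_matroid \<rho>"
  shows "shellable (independents \<rho>)"
proof -
  obtain f :: "('a, 'n) vec \<Rightarrow> nat" where f: "inj f"
    using finite_imp_inj_to_nat_seg[OF finite_class.finite_UNIV] by blast
  define lt where "lt x y \<longleftrightarrow> f x < f y" for x y
  have lin: "transp lt" "asymp lt" "totalp lt"
    using f by (auto simp: lt_def transp_def asymp_on_def totalp_on_def inj_eq neq_iff)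
      (metis inj_eq linorder_neqE_nat)
  have "transp (set_prec lt)"
    using set_prec_trans_if_linear[OF finite finite lin] by (intro transpI)
  moreover have "totalp (set_prec lt)"
    using set_prec_total_if_linear[OF finite finite _ lin(1,3)] by (intro totalpI)
  ultimately obtain Fs where Fs: "set Fs = facets (independents \<rho>)" "sorted_wrt (set_prec lt) Fs"
    using finite_list_of_linear_rel[of "facets (independents \<rho>)" "set_prec lt"]
    by (auto intro: transp_on_subset totalp_on_subset)
  then have "shelling (independents \<rho>) Fs"
    by (intro shelling_if_set_prec[OF M _ lin(2)]) (auto simp: sorted_wrt_iff_nth_less)
  then show ?thesis
    using q_complex_independents[OF M]
    by (auto simp: shellable_def pure_def facets_independents[OF M])
qed

subsection \<open>The order on subspaces\<close>

lemma
  fixes prec :: "'a::{field,finite} rel"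
  defines "lt \<equiv> lex_prec prec :: 'a ^ 'n::{finite,linorder} \<Rightarrow> ('a, 'n) vec \<Rightarrow> bool"
  assumes "scalar_order prec"
  shows transp_lex_prec: "transp lt" and asymp_lex_prec: "asymp lt" and totalp_lex_prec: "totalp lt"
  unfolding lt_def
proof -
  have tr: "(a, c) \<in> prec" if "(a, b) \<in> prec" "(b, c) \<in> prec" for a b c
    using assms that unfolding scalar_order_def strict_linear_order_on_def by (meson transD)
  have irr: "(a, a) \<notin> prec" for a
    using assms unfolding scalar_order_def strict_linear_order_on_def by (meson irreflD)
  have tot: "(a, b) \<in> prec \<or> (b, a) \<in> prec" if "a \<noteq> b" for a b
    using assms that unfolding scalar_order_def strict_linear_order_on_def total_on_def by blast
  show trp: "transp (lex_prec prec :: ('a, 'n) vec \<Rightarrow> _)"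
  proof (rule transpI)
    fix x y z :: "('a, 'n) vec" assume "lex_prec prec x y" "lex_prec prec y z"
    then obtain i k where i: "\<forall>j<i. x $ j = y $ j" "(x $ i, y $ i) \<in> prec"
      and k: "\<forall>j<k. y $ j = z $ j" "(y $ k, z $ k) \<in> prec"
      unfolding lex_prec_def by blast
    show "lex_prec prec x z"
    proof (cases i k rule: linorder_cases)
      case less
      then show ?thesis unfolding lex_prec_def using i k by (intro exI[of _ i]) auto
    next
      case equal
      then show ?thesis unfolding lex_prec_def using i k tr by (intro exI[of _ i]) auto
    next
      case greater
      then show ?thesis unfolding lex_prec_def using i k by (intro exI[of _ k]) auto
    qed
  qed
  have "\<not> lex_prec prec x x" for x :: "('a, 'n) vec" using irr unfolding lex_prec_def by blast
  then show "asymp (lex_prec prec :: ('a, 'n) vec \<Rightarrow> _)"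
    by (intro asympI) (blast dest: transpD[OF trp])
  show "totalp (lex_prec prec :: ('a, 'n) vec \<Rightarrow> _)"
  proof (rule totalpI)
    fix x y :: "('a, 'n) vec" assume "x \<noteq> y"
    then have ne: "{i. x $ i \<noteq> y $ i} \<noteq> {}" by (auto simp: vec_eq_iff)
    define i where "i = Min {i. x $ i \<noteq> y $ i}"
    have neq: "x $ i \<noteq> y $ i" using Min_in[OF _ ne] by (simp add: i_def)
    have "x $ j = y $ j" if "j < i" for j
      using that Min_le[of "{i. x $ i \<noteq> y $ i}" j] by (auto simp: i_def not_less[symmetric])
    then have "\<forall>j<i. x $ j = y $ j" "\<forall>j<i. y $ j = x $ j" by simp_all
    then show "lex_prec prec x y \<or> lex_prec prec y x"
      unfolding lex_prec_def using tot[OF neq] by blast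
  qed
qed

lemma lex_min_least:
  assumes "scalar_order prec" "S \<noteq> {}"
  shows "lex_min prec S \<in> S \<and> (\<forall>y\<in>S. y \<noteq> lex_min prec S \<longrightarrow> lex_prec prec (lex_min prec S) y)"
  unfolding lex_min_def
proof (rule theI')
  have asym: "\<not> lex_prec prec y x" if "lex_prec prec x y" for x y :: "('a, 'b) vec"
    by (rule asympD[OF asymp_lex_prec[OF assms(1)] that])
  have "\<exists>x\<in>S. \<forall>y\<in>S. y \<noteq> x \<longrightarrow> lex_prec prec x y"
    using assms transp_lex_prec[OF assms(1)] totalp_lex_prec[OF assms(1)]
    by (intro Finite_Set.bex_least_element) (auto intro: transp_on_subset totalp_on_subset)
  then show "\<exists>!x. x \<in> S \<and> (\<forall>y\<in>S. y \<noteq> x \<longrightarrow> lex_prec prec x y)"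
    by (metis asym)
qed

lemma lex_prec_span_drop:
  assumes ord: "scalar_order prec"
  shows "echelon_generator U us \<Longrightarrow> y \<in> U - vec.span (set (drop k us)) \<Longrightarrow>
    z \<in> vec.span (set (drop k us)) \<Longrightarrow> lex_prec prec z y"
proof (induction us arbitrary: U k)
  case Nil
  then show ?case by (simp add: echelon_generator_def)
next
  case (Cons u us)
  note U = echelon_generator_Cons[OF Cons.prems(1)]
  have sp: "vec.span (set (u # us)) = U" using Cons.prems(1) by (simp add: echelon_generator_def)
  show ?case
  proof (cases k)
    case 0
    then show ?thesis using Cons.prems(2) sp by simp
  next
    case (Suc m)
    have z: "z \<in> {x\<in>U. x $ pivot u = 0}"
      using Cons.prems(3) U(5) Suc vec.span_mono[OF set_drop_subset[of m us]]
      by (auto simp: echelon_generator_def)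
    show ?thesis
    proof (cases "y $ pivot u = 0")
      case True
      then show ?thesis using Cons.IH[OF U(5), of m] Cons.prems Suc by simp
    next
      case False
      have "(0, y $ pivot u) \<in> prec"
        using ord False unfolding scalar_order_def strict_linear_order_on_def
        by (cases "y $ pivot u = 1") (auto dest: transD)
      then show ?thesis
        unfolding lex_prec_def using z U(2) Cons.prems(2) by (intro exI[of _ "pivot u"]) auto
    qed
  qed
qed

lemma echelon_generator_drop:
  "echelon_generator U us \<Longrightarrow> \<exists>U'. echelon_generator U' (drop k us)"
proof (induction us arbitrary: U k)
  case (Cons u us)
  show ?case
    using Cons.prems Cons.IH[OF echelon_generator_Cons(5)[OF Cons.prems]] by (cases k) auto
qed auto

lemma lex_min_tower_layer:
  assumes ord: "scalar_order prec" and U: "vec.subspace U" and e: "1 \<le> e" "e \<le> vec.dim U"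
  shows "lex_min prec (tower_layer U e) \<in> U - tower U (e - 1)"
    and "\<And>y. y \<in> U - tower U (e - 1) \<Longrightarrow> y \<noteq> lex_min prec (tower_layer U e) \<Longrightarrow>
      lex_prec prec (lex_min prec (tower_layer U e)) y"
proof -
  obtain us where us: "echelon_generator U us" using echelon_generator_exists[OF U] by blast
  then have len: "length us = vec.dim U" and sp: "vec.span (set us) = U"
    by (auto simp: echelon_generator_def)
  define k where "k = vec.dim U - e"
  have T: "tower U e = vec.span (set (drop k us))"
    "tower U (e - 1) = vec.span (set (drop (Suc k) us))"
    using e len by (simp_all add: tower_eq[OF us] take_rev k_def Suc_diff_le)
  have TU: "tower U e \<subseteq> U"
    using vec.span_mono[OF set_drop_subset[of k us]] unfolding T sp .
  have "k < length us" using e len by (simp add: k_def)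
  then have dk: "drop k us = us ! k # drop (Suc k) us" by (rule Cons_nth_drop_Suc[symmetric])
  then obtain U' where U': "echelon_generator U' (us ! k # drop (Suc k) us)"
    using echelon_generator_drop[OF us, of k] by auto
  have "us ! k \<in> tower U e" unfolding T dk by (intro vec.span_base) simp
  moreover have "us ! k \<notin> tower U (e - 1)"
    using echelon_generator_Cons(3,5)[OF U'] unfolding T by (auto simp: echelon_generator_def)
  ultimately have "tower_layer U e \<noteq> {}" by (auto simp: tower_layer_def)
  note least = lex_min_least[OF ord this]
  then show "lex_min prec (tower_layer U e) \<in> U - tower U (e - 1)"
    using TU by (auto simp: tower_layer_def)
  fix y assume y: "y \<in> U - tower U (e - 1)" "y \<noteq> lex_min prec (tower_layer U e)"
  show "lex_prec prec (lex_min prec (tower_layer U e)) y"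
  proof (cases "y \<in> tower U e")
    case True
    then show ?thesis using y least by (auto simp: tower_layer_def)
  next
    case False
    then show ?thesis
      using lex_prec_span_drop[OF ord us, of y k] least y(1) unfolding T(1)[symmetric]
      by (auto simp: tower_layer_def)
  qed
qed

lemma subspace_le_imp_set_prec:
  assumes ord: "scalar_order prec" and U: "vec.subspace U" "vec.dim U = r"
    and V: "vec.subspace V" "vec.dim V = r" and le: "subspace_le prec r U V" "U \<noteq> V"
  shows "set_prec (lex_prec prec) U V"
proof -
  obtain e where e: "1 \<le> e" "e \<le> r" and eq: "\<forall>j<e. tower U j = tower V j"
    and less: "lex_prec prec (lex_min prec (tower_layer U e)) (lex_min prec (tower_layer V e))"
    using le by (auto simp: subspace_le_def)
  let ?u = "lex_min prec (tower_layer U e)" and ?v = "lex_min prec (tower_layer V e)"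
  have T: "tower U (e - 1) = tower V (e - 1)" using eq e by simp
  have u: "?u \<in> U - tower V (e - 1)" using lex_min_tower_layer(1)[OF ord U(1) e(1)] e U(2) T by simp
  have above: "lex_prec prec ?u y" if "y \<in> V - tower V (e - 1)" for y
    using lex_min_tower_layer(2)[OF ord V(1) e(1) _ that] e V(2) less
      transpD[OF transp_lex_prec[OF ord]] by metis
  have "?u \<notin> V"
  proof
    assume "?u \<in> V"
    then have "lex_prec prec ?u ?u" using above u by blast
    then show False using asympD[OF asymp_lex_prec[OF ord]] by blast
  qed
  moreover have "tower V (e - 1) \<subseteq> U"
  proof -
    obtain us where us: "echelon_generator U us" using echelon_generator_exists[OF U(1)] by blast
    have "vec.span (set (take (e - 1) (rev us))) \<subseteq> vec.span (set us)"
      by (intro vec.span_mono) (auto dest: in_set_takeD)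
    then show ?thesis using us unfolding T[symmetric] tower_eq[OF us] by (simp add: echelon_generator_def)
  qed
  ultimately show ?thesis unfolding set_prec_def using u above by blast
qed

theorem theorem4p4:
  fixes \<rho> :: "('a::{field,finite} ^ 'n::{finite,linorder}) set \<Rightarrow> nat" and r :: nat
  assumes "q_matroid \<rho>" and "\<rho> UNIV = r"
  shows "shellable (independents \<rho>) \<and>
    (\<forall>(prec :: 'a rel) Fs.
       scalar_order prec \<longrightarrow>
       set Fs = facets (independents \<rho>) \<longrightarrow>
       (\<forall>i j. i < j \<and> j < length Fs \<longrightarrow> subspace_le prec r (Fs ! i) (Fs ! j) \<and> Fs ! i \<noteq> Fs ! j) \<longrightarrow>
       shelling (independents \<rho>) Fs)"
proof (intro conjI allI impI)
  show "shellable (independents \<rho>)" by (rule shellable_independents[OF assms(1)])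
next
  fix prec :: "'a rel" and Fs
  assume ord: "scalar_order prec" and set: "set Fs = facets (independents \<rho>)"
    and le: "\<forall>i j. i < j \<and> j < length Fs \<longrightarrow>
      subspace_le prec r (Fs ! i) (Fs ! j) \<and> Fs ! i \<noteq> Fs ! j"
  have facet: "vec.subspace (Fs ! i) \<and> vec.dim (Fs ! i) = r" if "i < length Fs" for i
    using nth_mem[OF that] assms(2) unfolding set facets_independents[OF assms(1)]
    by (auto simp: independents_def)
  show "shelling (independents \<rho>) Fs"
  proof (rule shelling_if_set_prec[OF assms(1) set asymp_lex_prec[OF ord]])
    fix i j assume "i < j" "j < length Fs"
    then show "set_prec (lex_prec prec) (Fs ! i) (Fs ! j)"
      using facet[of i] facet[of j] le by (intro subspace_le_imp_set_prec[OF ord]) auto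
  qed
qed

end
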